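(* Let $A = 2M$ with $M$ a positive integer, let $B$ be a positive integer coprime to $A$, and let $\omega_k = \exp(2\pi i k/A)$, $\varphi_k = 2\pi k/A$. For $u \in [0,1)$ let $$L(u) = -\frac{B}{A} \sum_{k=0}^{A-1} \omega_k^B \operatorname{Log}(u - \omega_k),$$ where $\operatorname{Log}$ is the principal complex logarithm for $k \neq 0$ and the $k=0$ term $\operatorname{Log}(u-1)$ is read as $\ln(1-u)$. Then $$\begin{aligned} L(u) ={}& \frac{2B}{A} \operatorname{artanh}(u) + \frac{2B}{A} \sum_{k=1}^{\lfloor (M-1)/2 \rfloor} \cos(B\varphi_k) \operatorname{artanh}\frac{2u\cos\varphi_k}{u^2+1} - \frac{2B}{A} \sum_{k=1}^{\lfloor (M-1)/2 \rfloor} \sin(B\varphi_k) \arctan\frac{2u\sin\varphi_k}{u^2-1} \\ & + \frac{2B}{A} (-1)^{\frac{B-1}{2}} \arctan(u)\, \mathbb{1}_{\{2 \mid M\}} + \lambda_0, \end{aligned}$$ where $\lambda_0 = -\frac{\pi B}{A} \cot\frac{\pi B}{A}$.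
   Context: $\mathbb{1}_{\{2 \mid M\}}$ equals $1$ if $M$ is even and $0$ otherwise. Empty sums are $0$. The principal logarithm is $\operatorname{Log} z = \ln|z| + i\arg z$ with $\arg z \in (-\pi,\pi]$. Note that $B$ is odd, being coprime to the even integer $A$. *)

theory Defs
  imports "HOL-Analysis.Analysis"
begin

definition omega :: "nat \<Rightarrow> nat \<Rightarrow> complex" where
  "omega A k = exp (2 * of_real pi * \<i> * of_nat k / of_nat A)"

definition phi :: "nat \<Rightarrow> nat \<Rightarrow> real" where
  "phi A k = 2 * pi * real k / real A"

text \<open>
  The term for \<open>k = 0\<close>, formally \<open>Log (u - 1)\<close> with \<open>u - 1\<close> on the branch cut, is read as
  the real logarithm of \<open>1 - u\<close>.
\<close>

definition log_term :: "nat \<Rightarrow> real \<Rightarrow> nat \<Rightarrow> complex" where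
  "log_term A u k =
     (if k = 0 then complex_of_real (ln (1 - u)) else Ln (complex_of_real u - omega A k))"

definition L_fun :: "nat \<Rightarrow> nat \<Rightarrow> real \<Rightarrow> complex" where
  "L_fun A B u =
     - (of_nat B / of_nat A) * (\<Sum>k = 0..A - 1. omega A k ^ B * log_term A u k)"

definition lambda0 :: "nat \<Rightarrow> nat \<Rightarrow> real" where
  "lambda0 A B = - (pi * real B / real A) * cot (pi * real B / real A)"

end

theory Submission
  imports Defs
begin

text \<open>
  At \<open>u = 0\<close> every logarithm is explicit, \<open>Log (- \<omega>\<^sub>k) = i (\<phi>\<^sub>k - \<pi>)\<close>, and an arithmetico-geometric
  sum gives \<open>L(0) = \<lambda>\<^sub>0\<close>. In \<open>L(u) - L(0)\<close> the terms \<open>k\<close> and \<open>A - k\<close> are complex conjugate, so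
  only real parts for \<open>0 < k < M\<close> survive, besides \<open>k = 0\<close> and \<open>k = M\<close>, which produce
  \<open>artanh u\<close>. As \<open>B\<close> is odd, \<open>k \<mapsto> M - k\<close> negates \<open>cos (B \<phi>\<^sub>k)\<close> and fixes \<open>sin (B \<phi>\<^sub>k)\<close>;
  folding once more combines the logarithms into \<open>artanh\<close> and the arguments into \<open>arctan\<close>,
  with a middle term \<open>k = M / 2\<close> for even \<open>M\<close>.
\<close>

section \<open>Folding of finite sums, and auxiliary facts on \<open>arctan\<close> and
  \<open>Ln\<close>\<close>

text \<open>The reflection \<open>k \<mapsto> n - k\<close> fixes only \<open>n div 2\<close>, and
  only for even \<open>n\<close>. Used with \<open>n = A\<close> for complex conjugation and again
  with \<open>n = M\<close>.\<close>

lemma sum_fold_symmetric: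
  fixes f :: "nat \<Rightarrow> 'a::comm_monoid_add"
  assumes "n > 0"
  shows "sum f {1..n - 1} =
    (\<Sum>k = 1..(n - 1) div 2. f k + f (n - k)) + (if even n then f (n div 2) else 0)"
proof -
  let ?m = "(n - 1) div 2"
  have upper: "(\<Sum>k = 1..?m. f (n - k)) = sum f {n - ?m..n - 1}"
    by (rule sum.reindex_bij_witness[of _ "\<lambda>k. n - k" "\<lambda>k. n - k"]) (use assms in auto)
  have "{1..n - 1} = {1..?m} \<union> {n - ?m..n - 1} \<union> (if even n then {n div 2} else {})"
    using assms by (auto elim!: oddE evenE)
  moreover have "{1..?m} \<inter> {n - ?m..n - 1} = {}"
    using assms by auto
  moreover have "({1..?m} \<union> {n - ?m..n - 1}) \<inter> (if even n then {n div 2} else {}) = {}"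
    using assms by (auto elim!: evenE)
  ultimately have "sum f {1..n - 1} = sum f {1..?m} + sum f {n - ?m..n - 1}
      + sum f (if even n then {n div 2} else {})"
    by (simp add: sum.union_disjoint)
  then show ?thesis
    by (auto simp: sum.distrib simp del: One_nat_def simp flip: upper)
qed

lemma arithmetico_geometric_sum:
  fixes z :: "'a::comm_ring_1"
  shows "(z - 1) * (\<Sum>k<n. of_nat k * z ^ k) = of_nat n * z ^ n - (\<Sum>k<n. z ^ Suc k)"
  by (induction n) (auto simp: algebra_simps)

text \<open>A product below 1 keeps the sum of the arctangents within \<open>(-pi/2, pi/2)\<close>,
  so no multiple of \<open>pi\<close> enters. It will be applied to \<open>(u - c) / s\<close> and
  \<open>(u + c) / s\<close>, which may be large.\<close>

lemma arctan_add_prod_less_1: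
  fixes x y :: real
  assumes "x * y < 1"
  shows "arctan x + arctan y = arctan ((x + y) / (1 - x * y))"
proof (rule arctan_add_raw)
  \<comment> \<open>For positive \<open>a\<close>, compare \<open>b < 1 / a\<close> with the
    identity \<open>arctan a + arctan (1 / a) = pi / 2\<close>.\<close>
  have pos: "arctan a + arctan b < pi / 2" if "a > 0" "a * b < 1" for a b :: real
  proof -
    have "b < 1 / a"
      using that by (simp add: field_simps)
    then have "arctan b < arctan (1 / a)"
      by (simp add: arctan_less_iff)
    then show ?thesis
      using arctan_inverse[of a] that by (simp add: sgn_real_def inverse_eq_divide)
  qed
  have upper: "arctan a + arctan b < pi / 2" if "a * b < 1" for a b :: real
  proof (cases "a > 0")
    case False
    then show ?thesis
      using arctan_ubound[of b] arctan_le_zero_iff[of a] by linarith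
  qed (use that pos in auto)
  \<comment> \<open>Negating both arguments keeps their product, so the upper bound also yields the
    lower one.\<close>
  show "\<bar>arctan x + arctan y\<bar> < pi / 2"
    using upper[of x y] upper[of "- x" "- y"] assms unfolding abs_less_iff
    by (simp add: arctan_minus)
qed

text \<open>Multiplication by \<open>\<i>\<close> rotates the lower half plane onto the right one,
  where \<open>arctan\<close> gives the argument. Dividing by \<open>Im z\<close> avoids a case
  split at \<open>Re z = 0\<close>.\<close>

lemma Im_Ln_lower_half_plane:
  assumes "Im z < 0"
  shows "Im (Ln z) = arctan (- Re z / Im z) - pi / 2"
proof -
  define t where "t = arctan (- Re z / Im z)"
  have t: "- (pi / 2) < t" "t < pi / 2"
    using arctan_bounded[of "- Re z / Im z"] by (auto simp: t_def)
  then have "cos t > 0"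
    by (simp add: cos_gt_zero_pi)
  \<comment> \<open>The modulus of \<open>z\<close>, read off from
    \<open>Im z = - r * cos t\<close>.\<close>
  define r where "r = - Im z / cos t"
  have "r > 0"
    using \<open>cos t > 0\<close> assms by (simp add: r_def divide_neg_pos)
  have "tan t = - Re z / Im z"
    by (simp add: t_def tan_arctan)
  then have "Re z = r * sin t"
    using assms \<open>cos t > 0\<close> by (simp add: r_def tan_def field_simps)
  moreover have "Im z = - (r * cos t)"
    using \<open>cos t > 0\<close> by (simp add: r_def)
  ultimately have "exp (Complex (ln r) (t - pi / 2)) = z"
    using \<open>r > 0\<close> by (simp add: complex_eq_iff Re_exp Im_exp cos_diff sin_diff)
  then have "Ln z = Complex (ln r) (t - pi / 2)"
    using t by (intro Ln_unique) auto
  then show ?thesis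
    by (simp add: t_def)
qed

section \<open>Roots of unity, their symmetries, and the logarithmic terms\<close>

lemma omega_eq_cis: "omega A k = cis (phi A k)"
  by (simp add: omega_def phi_def cis_conv_exp mult_ac)

lemma omega_power_eq_cis: "omega A k ^ B = cis (real B * phi A k)"
  by (simp add: omega_eq_cis Complex.DeMoivre)

lemma phi_diff:
  assumes "A > 0" "k \<le> A"
  shows "phi A (A - k) = 2 * pi - phi A k"
  using assms by (simp add: phi_def of_nat_diff field_simps)

lemma phi_half_diff:
  assumes "M > 0" "k \<le> M"
  shows "phi (2 * M) (M - k) = pi - phi (2 * M) k"
  using assms by (simp add: phi_def of_nat_diff field_simps)

lemma omega_diff_eq_cnj:
  assumes "A > 0" "k \<le> A"
  shows "omega A (A - k) = cnj (omega A k)"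
  using assms by (simp add: omega_eq_cis phi_diff complex_eq_iff sin_diff cos_diff)

lemma sin_phi_pos:
  assumes "0 < k" "k < M"
  shows "sin (phi (2 * M) k) > 0"
  using assms by (intro sin_gt_zero) (auto simp: phi_def field_simps)

lemma log_term_0:
  assumes "0 < k" "k < A"
  shows "log_term A 0 k = \<i> * of_real (phi A k - pi)"
proof -
  have "0 < phi A k" "phi A k < 2 * pi"
    using assms by (auto simp: phi_def field_simps)
  moreover have "exp (\<i> * of_real (phi A k - pi)) = - omega A k"
    unfolding cis_conv_exp[symmetric] by (simp add: omega_eq_cis complex_eq_iff)
  ultimately have "Ln (- omega A k) = \<i> * of_real (phi A k - pi)"
    by (intro Ln_unique) auto
  then show ?thesis
    using assms by (simp add: log_term_def)
qed

text \<open>For \<open>0 < k < M\<close> the point \<open>u - omega (2 * M) k\<close> lies in the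
  open lower half plane, hence off the branch cut, where \<open>Ln\<close> commutes with
  conjugation.\<close>

lemma log_term_diff:
  assumes "0 < k" "k < M"
  shows "log_term (2 * M) u (2 * M - k) = cnj (log_term (2 * M) u k)"
proof -
  have "Im (complex_of_real u - omega (2 * M) k) < 0"
    using sin_phi_pos[OF assms] by (simp add: omega_eq_cis)
  then have "complex_of_real u - omega (2 * M) k \<notin> \<real>\<^sub>\<le>\<^sub>0"
    by (auto simp: complex_nonpos_Reals_iff)
  then show ?thesis
    using assms by (simp add: log_term_def cnj_Ln omega_diff_eq_cnj)
qed

section \<open>The constant term: the value at \<open>u = 0\<close>\<close>

lemma L_fun_0:
  assumes "A > 1" "coprime B A"
  shows "L_fun A B 0 = of_real (lambda0 A B)"
proof -
  define \<theta> where "\<theta> = pi * real B / real A"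
  define z where "z = cis (2 * \<theta>)"
  have z_pow: "omega A k ^ B = z ^ k" for k
    by (simp add: omega_power_eq_cis z_def Complex.DeMoivre \<theta>_def phi_def mult_ac)
  have z_A: "z ^ A = 1"
    using assms by (simp add: z_def Complex.DeMoivre \<theta>_def mult_ac)
      (metis cis_multiple_2pi Ints_of_nat mult.assoc mult.commute)
  \<comment> \<open>This is where coprimality enters: otherwise \<open>A\<close> would divide
    \<open>B\<close>. It gives \<open>z \<noteq> 1\<close>.\<close>
  have sin_nz: "sin \<theta> \<noteq> 0"
  proof
    assume "sin \<theta> = 0"
    then obtain i :: int where "\<theta> = of_int i * pi"
      by (auto simp: sin_zero_iff_int2)
    then have "real B = of_int i * real A"
      using assms by (simp add: \<theta>_def field_simps)
    then have "int B = i * int A"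
      by (metis of_int_eq_iff of_int_mult of_int_of_nat_eq)
    then have "int A dvd int B"
      by simp
    then have "A dvd B"
      by simp
    then have "is_unit A"
      using assms by (meson coprime_common_divisor dvd_refl)
    then show False
      using assms by simp
  qed
  \<comment> \<open>Extracting the half-angle factor \<open>cis \<theta>\<close> turns
    \<open>(z + 1) / (z - 1)\<close> into \<open>- \<i> * cot \<theta>\<close>.\<close>
  have z_minus: "z - 1 = 2 * \<i> * sin \<theta> * cis \<theta>" and z_plus: "z + 1 = 2 * cos \<theta> * cis \<theta>"
    using sin_cos_squared_add[of \<theta>]
    by (auto simp: z_def complex_eq_iff sin_double cos_double power2_eq_square)
  have "z \<noteq> 1"
    using z_minus sin_nz by auto
  have geom: "(\<Sum>k<A. z ^ k) = 0"
    using \<open>z \<noteq> 1\<close> z_A by (simp add: geometric_sum)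
  have "(z - 1) * (\<Sum>k<A. of_nat k * z ^ k) = of_nat A"
    using arithmetico_geometric_sum[of z A] geom z_A by (simp flip: sum_distrib_left)
  then have ag: "(\<Sum>k<A. of_nat k * z ^ k) = of_nat A / (z - 1)"
    using \<open>z \<noteq> 1\<close> by (simp add: field_simps)
  \<comment> \<open>At \<open>k = 0\<close> the term is \<open>ln 1 = 0\<close>, whereas the general
    formula would give \<open>- \<i> * pi\<close>; the last summand corrects this.\<close>
  have "(\<Sum>k = 0..A - 1. omega A k ^ B * log_term A 0 k)
      = (\<Sum>k<A. \<i> * of_real (2 * pi / A) * (of_nat k * z ^ k) - \<i> * pi * z ^ k
          + (if k = 0 then \<i> * pi else 0))"
  proof (rule sum.cong)
    show "{0..A - 1} = {..<A}"
      using assms by auto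
    fix k assume "k \<in> {..<A}"
    then show "omega A k ^ B * log_term A 0 k = \<i> * of_real (2 * pi / A) * (of_nat k * z ^ k)
        - \<i> * pi * z ^ k + (if k = 0 then \<i> * pi else 0)"
      by (cases "k = 0") (simp_all add: z_pow log_term_0 phi_def algebra_simps,
          simp add: log_term_def)
  qed
  also have "\<dots> = \<i> * of_real (2 * pi / A) * (\<Sum>k<A. of_nat k * z ^ k)
      - \<i> * pi * (\<Sum>k<A. z ^ k) + \<i> * pi"
    using assms by (simp add: sum.distrib sum_subtractf sum_distrib_left)
  also have "\<dots> = \<i> * pi * (z + 1) / (z - 1)"
    using assms \<open>z \<noteq> 1\<close> by (simp add: geom ag field_simps)
  also have "\<dots> = of_real (pi * cot \<theta>)"
    using sin_nz by (simp add: z_plus z_minus cot_def sin_of_real cos_of_real)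
  finally show ?thesis
    by (simp add: L_fun_def lambda0_def \<theta>_def)
qed

section \<open>Folding the sum for general \<open>u\<close>\<close>

theorem lemma4:
  fixes A B M :: nat and u :: real
  assumes "M > 0" and "A = 2 * M"
    and "B > 0" and "coprime B A"
    and "0 \<le> u" and "u < 1"
  shows "L_fun A B u = complex_of_real (
      2 * real B / real A * artanh u
    + 2 * real B / real A *
        (\<Sum>k = 1..(M - 1) div 2. cos (real B * phi A k) *
           artanh (2 * u * cos (phi A k) / (u\<^sup>2 + 1)))
    - 2 * real B / real A *
        (\<Sum>k = 1..(M - 1) div 2. sin (real B * phi A k) *
           arctan (2 * u * sin (phi A k) / (u\<^sup>2 - 1)))
    + 2 * real B / real A * (-1) ^ ((B - 1) div 2) * arctan u * (if 2 dvd M then 1 else 0)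
    + lambda0 A B)"
proof -
  define D where "D k = omega A k ^ B * (log_term A u k - log_term A 0 k)" for k
  define R where "R k = Re (D k)" for k
  let ?m = "(M - 1) div 2"
  have "odd B"
    using assms by auto
  have "A > 1"
    using assms by simp
  \<comment> \<open>Taking the difference with \<open>u = 0\<close> cancels the shifts by
    \<open>- pi / 2\<close>, and the modulus part at 0 vanishes since
    \<open>ln 1 = 0\<close>.\<close>
  have R_eq: "R k = cos (B * phi A k) * (ln (u\<^sup>2 - 2 * u * cos (phi A k) + 1) / 2)
      - sin (B * phi A k) * (arctan ((u - cos (phi A k)) / sin (phi A k))
          - arctan (- cos (phi A k) / sin (phi A k)))"
    if k: "0 < k" "k < M" for k
  proof -
    define c s where "c = cos (phi A k)" and "s = sin (phi A k)"
    have "s > 0"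
      using sin_phi_pos[OF k] assms by (simp add: s_def)
    have Re_log: "Re (log_term A v k) = ln (v\<^sup>2 - 2 * v * c + 1) / 2"
      and Im_log: "Im (log_term A v k) = arctan ((v - c) / s) - pi / 2" for v
    proof -
      define w where "w = complex_of_real v - omega A k"
      have w: "Re w = v - c" "Im w = - s"
        by (simp_all add: w_def omega_eq_cis c_def s_def)
      have lt: "log_term A v k = Ln w"
        using k by (simp add: log_term_def w_def)
      have "(cmod w)\<^sup>2 = v\<^sup>2 - 2 * v * c + 1"
        using sin_cos_squared_add2[of "phi A k"]
        by (simp add: cmod_power2 w power2_diff) (simp add: c_def s_def)
      moreover have "w \<noteq> 0"
        using w \<open>s > 0\<close> by auto
      ultimately show "Re (log_term A v k) = ln (v\<^sup>2 - 2 * v * c + 1) / 2"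
        using ln_realpow[of "cmod w" 2] by (simp add: lt)
      have "- Re w / Im w = (v - c) / s"
        by (metis minus_diff_eq minus_divide_divide w)
      then show "Im (log_term A v k) = arctan ((v - c) / s) - pi / 2"
        using Im_Ln_lower_half_plane[of w] \<open>s > 0\<close> w(2) by (simp only: lt)
    qed
    show ?thesis
      using Re_log[of u] Re_log[of 0] Im_log[of u] Im_log[of 0]
      by (simp add: R_def D_def omega_power_eq_cis flip: c_def s_def)
  qed
  \<comment> \<open>The reflection sends \<open>c\<close> to \<open>- c\<close> and \<open>C\<close>
    to \<open>- C\<close> but fixes \<open>s\<close> and \<open>S\<close>, so the two logarithms are
    subtracted, the two arctangents in \<open>u\<close> are added, and the constants
    \<open>arctan (c / s)\<close> cancel.\<close>
  have R_pair: "R k + R (M - k) =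
      - (cos (B * phi A k) * artanh (2 * u * cos (phi A k) / (u\<^sup>2 + 1)))
      + sin (B * phi A k) * arctan (2 * u * sin (phi A k) / (u\<^sup>2 - 1))"
    if k: "0 < k" "k < M" for k
  proof -
    define c s C S where "c = cos (phi A k)" and "s = sin (phi A k)"
      and "C = cos (B * phi A k)" and "S = sin (B * phi A k)"
    have "s > 0"
      using sin_phi_pos[OF k] assms by (simp add: s_def)
    have cs: "c\<^sup>2 + s\<^sup>2 = 1"
      by (simp add: c_def s_def)
    have phi: "phi A (M - k) = pi - phi A k"
      using phi_half_diff[of M k] k assms by simp
    have refl: "cos (phi A (M - k)) = - c" "sin (phi A (M - k)) = s"
      "cos (B * phi A (M - k)) = - C" "sin (B * phi A (M - k)) = S"
      using \<open>odd B\<close> by (simp_all add: phi c_def s_def C_def S_def right_diff_distrib cos_diff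
          sin_diff)
    have pos: "u\<^sup>2 - 2 * u * c + 1 > 0" "u\<^sup>2 + 2 * u * c + 1 > 0"
    proof -
      have "u\<^sup>2 - 2 * u * c + 1 = (u - c)\<^sup>2 + s\<^sup>2" "u\<^sup>2 + 2 * u * c + 1 = (u + c)\<^sup>2 + s\<^sup>2"
        using cs by (auto simp: power2_eq_square algebra_simps)
      then show "u\<^sup>2 - 2 * u * c + 1 > 0" "u\<^sup>2 + 2 * u * c + 1 > 0"
        using \<open>s > 0\<close> by (simp_all add: add_nonneg_pos)
    qed
    have "u\<^sup>2 + 1 > 0"
      by (simp add: add_nonneg_pos)
    then have "(1 + 2 * u * c / (u\<^sup>2 + 1)) / (1 - 2 * u * c / (u\<^sup>2 + 1))
        = (u\<^sup>2 + 2 * u * c + 1) / (u\<^sup>2 - 2 * u * c + 1)"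
      using pos by (simp add: divide_simps) (simp add: algebra_simps)
    then have artanh: "artanh (2 * u * c / (u\<^sup>2 + 1))
        = (ln (u\<^sup>2 + 2 * u * c + 1) - ln (u\<^sup>2 - 2 * u * c + 1)) / 2"
      using pos by (simp add: artanh_def ln_div)
    have "u\<^sup>2 < 1"
      using assms by (simp add: power_less_one_iff abs_square_less_1)
    \<comment> \<open>From \<open>c\<^sup>2 + s\<^sup>2 = 1\<close>; as \<open>u\<^sup>2 < 1\<close>
      the right side is positive, which is the condition of
      \<open>arctan_add_prod_less_1\<close>.\<close>
    have quot: "1 - (u - c) / s * ((u + c) / s) = (1 - u\<^sup>2) / s\<^sup>2"
      using cs \<open>s > 0\<close> by (simp add: field_simps power2_eq_square)
    then have "(u - c) / s * ((u + c) / s) < 1"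
      using \<open>u\<^sup>2 < 1\<close> \<open>s > 0\<close> by (smt (verit) divide_pos_pos zero_less_power)
    then have "arctan ((u - c) / s) + arctan ((u + c) / s)
        = arctan (((u - c) / s + (u + c) / s) / ((1 - u\<^sup>2) / s\<^sup>2))"
      using arctan_add_prod_less_1 quot by metis
    also have "((u - c) / s + (u + c) / s) / ((1 - u\<^sup>2) / s\<^sup>2) = - (2 * u * s / (u\<^sup>2 - 1))"
    proof -
      have "(u - c) / s + (u + c) / s = 2 * u / s"
        by (simp flip: add_divide_distrib)
      then have "((u - c) / s + (u + c) / s) / ((1 - u\<^sup>2) / s\<^sup>2) = 2 * u * s / (1 - u\<^sup>2)"
        using \<open>s > 0\<close> by (simp add: power2_eq_square)
      then show ?thesis
        by (metis minus_diff_eq minus_divide_right)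
    qed
    finally have arctan: "arctan (2 * u * s / (u\<^sup>2 - 1))
        = - (arctan ((u - c) / s) + arctan ((u + c) / s))"
      by (simp add: arctan_minus)
    have "R k = C * (ln (u\<^sup>2 - 2 * u * c + 1) / 2) - S * (arctan ((u - c) / s) + arctan (c / s))"
      using R_eq[OF k] by (simp add: arctan_minus flip: c_def s_def C_def S_def)
    moreover have "R (M - k) = - (C * (ln (u\<^sup>2 + 2 * u * c + 1) / 2))
        - S * (arctan ((u + c) / s) - arctan (c / s))"
      using R_eq[of "M - k"] k by (simp add: refl)
    ultimately show ?thesis
      unfolding c_def[symmetric] s_def[symmetric] C_def[symmetric] S_def[symmetric] artanh arctan
      by (simp add: field_simps)
  qed
  \<comment> \<open>Here the angle is \<open>pi / 2\<close>: the cosine of an odd multiple of it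
    vanishes, and the sine supplies the sign.\<close>
  have R_mid: "R (M div 2) = - ((-1) ^ ((B - 1) div 2) * arctan u)" if "even M"
  proof -
    obtain b where b: "B = 2 * b + 1"
      using \<open>odd B\<close> by (elim oddE)
    have phi: "phi A (M div 2) = pi / 2"
      using that assms by (auto simp: phi_def elim!: evenE)
    have Bphi: "B * (pi / 2) = b * pi + pi / 2"
      by (simp add: b field_simps)
    show ?thesis
      using R_eq[of "M div 2"] that assms(1)
      unfolding phi Bphi by (auto simp: cos_add sin_add b elim!: evenE)
  qed
  \<comment> \<open>As \<open>B\<close> is odd, the weights at \<open>k = 0\<close> and
    \<open>k = M\<close> are 1 and -1, leaving \<open>ln (1 - u) - ln (1 + u)\<close>.\<close>
  have D_ends: "D 0 + D M = - 2 * of_real (artanh u)"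
  proof -
    have "phi A M = pi"
      using assms by (simp add: phi_def)
    then have "omega A M = -1" "omega A 0 = 1"
      by (simp_all add: omega_eq_cis phi_def)
    moreover have "Ln (of_real u + 1) = of_real (ln (u + 1))"
      using Ln_of_real[of "u + 1"] assms by simp
    ultimately have "D 0 + D M = of_real (ln (1 - u) - ln (1 + u))"
      using assms \<open>odd B\<close> by (simp add: D_def log_term_def add.commute)
    also have "ln (1 - u) - ln (1 + u) = - 2 * artanh u"
      using assms by (simp add: artanh_def ln_div)
    finally show ?thesis
      by simp
  qed
  have "D k + D (A - k) = of_real (2 * R k)" if "0 < k" "k < M" for k
  proof -
    have "D (A - k) = cnj (D k)"
      using that assms(2) by (simp add: D_def omega_diff_eq_cnj log_term_diff)
    then show ?thesis
      by (simp add: complex_add_cnj R_def)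
  qed
  then have fold_D: "(\<Sum>k = 1..M - 1. D k + D (A - k)) = of_real (2 * (\<Sum>k = 1..M - 1. R k))"
    by (auto simp: sum_distrib_left intro!: sum.cong)
  \<comment> \<open>Folding at \<open>A = 2 * M\<close> pairs the indices below \<open>M\<close> and
    leaves \<open>M\<close> itself as the middle index, to be joined with index 0 through
    \<open>D_ends\<close>.\<close>
  have "(A - 1) div 2 = M - 1"
    using assms by simp
  then have "sum D {1..A - 1} = of_real (2 * (\<Sum>k = 1..M - 1. R k)) + D M"
    using sum_fold_symmetric[of A D] fold_D assms by simp
  moreover have "sum D {0..A - 1} = D 0 + sum D {1..A - 1}"
    by (simp add: sum.atLeast_Suc_atMost)
  ultimately have sum_D: "sum D {0..A - 1} = of_real (2 * (\<Sum>k = 1..M - 1. R k) - 2 * artanh u)"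
    using D_ends[folded eq_diff_eq] by simp
  have "(\<Sum>k = 1..M - 1. R k) = (\<Sum>k = 1..?m. R k + R (M - k)) + (if even M then R (M div 2) else 0)"
    using assms by (intro sum_fold_symmetric)
  also have "(\<Sum>k = 1..?m. R k + R (M - k)) = (\<Sum>k = 1..?m.
      - (cos (B * phi A k) * artanh (2 * u * cos (phi A k) / (u\<^sup>2 + 1)))
      + sin (B * phi A k) * arctan (2 * u * sin (phi A k) / (u\<^sup>2 - 1)))"
    by (intro sum.cong refl R_pair) auto
  finally have sum_R: "(\<Sum>k = 1..M - 1. R k) =
      - (\<Sum>k = 1..?m. cos (B * phi A k) * artanh (2 * u * cos (phi A k) / (u\<^sup>2 + 1)))
      + (\<Sum>k = 1..?m. sin (B * phi A k) * arctan (2 * u * sin (phi A k) / (u\<^sup>2 - 1)))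
      - (-1) ^ ((B - 1) div 2) * arctan u * (if 2 dvd M then 1 else 0)"
    by (simp only: sum.distrib sum_negf) (simp add: R_mid)
  have "L_fun A B u - L_fun A B 0 = - (of_nat B / of_nat A) * sum D {0..A - 1}"
    by (simp add: L_fun_def D_def right_diff_distrib sum_subtractf)
  then have "L_fun A B u =
      of_real (- (real B / real A) * (2 * (\<Sum>k = 1..M - 1. R k) - 2 * artanh u) + lambda0 A B)"
    using L_fun_0[OF \<open>A > 1\<close> assms(4)] unfolding sum_D by (simp add: algebra_simps)
  then show ?thesis
    unfolding sum_R by (simp only: of_real_eq_iff) (simp add: algebra_simps)
qed

end
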